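(* Let $p,q\in\mathbb R$ and consider, for $z=(x,y)^T\in\mathbb R^2$, the vector equation $$z\circledast z+p\,z+q\,\mathbf 1=\mathfrak o .$$ (a) If $q-\frac{p^2}{4}>0$, then the solutions $z\in\mathbb R^2$ of this equation are $$z_{1/2}=-\frac p2\,\mathbf 1\pm\sqrt{q-\frac{p^2}{4}}\;\mathbf I .$$ (b) If $\frac{p^2}{4}-q\ge 0$, then the solutions $z\in\mathbb R^2$ of this equation are $$z_{1/2}=(x_{1/2},\,0)^T,\qquad\text{where } x_{1/2}=-\frac p2\pm\sqrt{\frac{p^2}{4}-q}.$$
   Context: Vectors in $\mathbb R^2$ are columns; addition and multiplication by real scalars are the usual componentwise operations. Notation: $\mathbf 1=(1,0)^T$, $\mathbf I=(0,1)^T$, $\mathfrak o=(0,0)^T$. The circular vector-valued product on $\mathbb R^2$ is $$(x_1,\,y_1)^T\circledast(x_2,\,y_2)^T=(x_1x_2-y_1y_2,\; x_1y_2+x_2y_1)^T.$$ *)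

theory Defs
  imports "HOL-Analysis.Analysis"
begin

definition circ_prod :: "real^2 \<Rightarrow> real^2 \<Rightarrow> real^2"  (infixl "\<odot>" 70) where
  "u \<odot> v = vector [u$1 * v$1 - u$2 * v$2, u$1 * v$2 + v$1 * u$2]"

definition vone :: "real^2" where
  "vone = vector [1, 0]"

definition vimag :: "real^2" where
  "vimag = vector [0, 1]"

end

theory Submission
  imports Defs
begin

text \<open>Completing the square turns the equation into $w \odot w = (p^2/4 - q) \mathbf 1$ for
  $w = z + (p/2) \mathbf 1$. The second component forces one coordinate of $w$ to vanish, and the sign
  of $p^2/4 - q$ decides which.\<close>

lemma vec2_eq_iff: "u = v \<longleftrightarrow> u$1 = v$1 \<and> u$2 = v$2" for u v :: "real^2"
  by (simp add: vec_eq_iff forall_2)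

text \<open>Componentwise, completing the square makes the first entry of the left side a difference
  of two squares minus the constant \<open>p\<^sup>2/4 - q\<close>, while the second entry is twice
  the product of the shifted first coordinate and \<open>z$2\<close>. Both cases of the theorem
  start from this real system.\<close>

lemma circ_quadratic_iff:
  fixes z :: "real^2"
  shows "z \<odot> z + p *\<^sub>R z + q *\<^sub>R vone = 0 \<longleftrightarrow>
    (z$1 + p/2) * z$2 = 0 \<and> (z$1 + p/2)\<^sup>2 - (z$2)\<^sup>2 = p\<^sup>2/4 - q"
proof -
  have "z$1 * z$1 - z$2 * z$2 + p * z$1 + q = (z$1 + p/2)\<^sup>2 - (z$2)\<^sup>2 - (p\<^sup>2/4 - q)"
    by (simp add: power2_eq_square field_simps)
  moreover have "z$1 * z$2 + z$1 * z$2 + p * z$2 = 2 * ((z$1 + p/2) * z$2)"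
    by (simp add: field_simps)
  ultimately show ?thesis
    unfolding vec2_eq_iff circ_prod_def vone_def by auto
qed

lemma power2_eq_iff_sqrt: "a\<^sup>2 = c \<longleftrightarrow> a = sqrt c \<or> a = - sqrt c" if "c \<ge> 0" for a c :: real
  using that power2_eq_iff[of a "sqrt c"] by simp

text \<open>Solves the real system when its right side is negative; applied with
  \<open>a = z$1 + p/2\<close>, \<open>b = z$2\<close> and
  \<open>c = q - p\<^sup>2/4\<close>.\<close>

lemma square_diff_eq_pos_iff:
  fixes a b c :: real
  assumes "c > 0"
  shows "a * b = 0 \<and> a\<^sup>2 - b\<^sup>2 = - c \<longleftrightarrow> a = 0 \<and> (b = sqrt c \<or> b = - sqrt c)"
proof -
  \<comment> \<open>With \<open>b = 0\<close> the equation would give a square equal to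
    \<open>- c < 0\<close>, so this branch of \<open>a * b = 0\<close> is contradictory and any
    conclusion follows.\<close>
  have "a = 0" if "b = 0" "a\<^sup>2 - b\<^sup>2 = - c"
    using that assms by (smt (verit) zero_le_power2 zero_power2)
  then have "a * b = 0 \<and> a\<^sup>2 - b\<^sup>2 = - c \<longleftrightarrow> a = 0 \<and> b\<^sup>2 = c"
    by auto
  then show ?thesis
    using assms by (simp add: power2_eq_iff_sqrt)
qed

text \<open>The mirror case, in which the other coordinate vanishes. For \<open>c = 0\<close> both
  coordinates are zero and the two square roots coincide, so the double root is covered.\<close>

lemma square_diff_eq_nonneg_iff:
  fixes a b c :: real
  assumes "c \<ge> 0"
  shows "a * b = 0 \<and> a\<^sup>2 - b\<^sup>2 = c \<longleftrightarrow> b = 0 \<and> (a = sqrt c \<or> a = - sqrt c)"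
proof -
  \<comment> \<open>Here the branch need not be contradictory:
    \<open>- b\<^sup>2 = c \<ge> 0\<close> still allows \<open>b = 0\<close>, and only that.\<close>
  have "b = 0" if "a = 0" "a\<^sup>2 - b\<^sup>2 = c"
    using that assms by (smt (verit) power2_less_eq_zero_iff zero_power2)
  then have "a * b = 0 \<and> a\<^sup>2 - b\<^sup>2 = c \<longleftrightarrow> b = 0 \<and> a\<^sup>2 = c"
    by auto
  then show ?thesis
    using assms by (simp add: power2_eq_iff_sqrt)
qed

theorem theorem3p1:
  fixes p q :: real
  shows "(q - p\<^sup>2 / 4 > 0 \<longrightarrow>
           {z :: real^2. z \<odot> z + p *\<^sub>R z + q *\<^sub>R vone = 0} =
             {(- p / 2) *\<^sub>R vone + sqrt (q - p\<^sup>2 / 4) *\<^sub>R vimag,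
              (- p / 2) *\<^sub>R vone - sqrt (q - p\<^sup>2 / 4) *\<^sub>R vimag})
       \<and> (p\<^sup>2 / 4 - q \<ge> 0 \<longrightarrow>
           {z :: real^2. z \<odot> z + p *\<^sub>R z + q *\<^sub>R vone = 0} =
             {vector [- p / 2 + sqrt (p\<^sup>2 / 4 - q), 0],
              vector [- p / 2 - sqrt (p\<^sup>2 / 4 - q), 0]})"
proof (intro conjI impI)
  assume pos: "q - p\<^sup>2 / 4 > 0"
  define s where "s = sqrt (q - p\<^sup>2 / 4)"
  have "z \<odot> z + p *\<^sub>R z + q *\<^sub>R vone = 0 \<longleftrightarrow>
      z = (- p / 2) *\<^sub>R vone + s *\<^sub>R vimag \<or> z = (- p / 2) *\<^sub>R vone - s *\<^sub>R vimag" for z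
  proof -
    have "z \<odot> z + p *\<^sub>R z + q *\<^sub>R vone = 0 \<longleftrightarrow>
        z$1 + p / 2 = 0 \<and> (z$2 = s \<or> z$2 = - s)"
      \<comment> \<open>The lemma has \<open>- (q - p\<^sup>2/4)\<close> on the right;
        \<open>minus_diff_eq\<close> turns it into the \<open>p\<^sup>2/4 - q\<close> of
        \<open>circ_quadratic_iff\<close>.\<close>
      using square_diff_eq_pos_iff[OF pos, of "z$1 + p/2" "z$2"]
      unfolding circ_quadratic_iff s_def minus_diff_eq .
    also have "z$1 + p / 2 = 0 \<longleftrightarrow> z$1 = - p / 2"
      by linarith
    finally show ?thesis
      \<comment> \<open>Distributing the common condition on \<open>z$1\<close> over the two signs
        of \<open>s\<close> gives one vector equation per sign.\<close>
      by (simp add: vec2_eq_iff vone_def vimag_def conj_disj_distribL)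
  qed
  then show "{z :: real^2. z \<odot> z + p *\<^sub>R z + q *\<^sub>R vone = 0} =
             {(- p / 2) *\<^sub>R vone + sqrt (q - p\<^sup>2 / 4) *\<^sub>R vimag,
              (- p / 2) *\<^sub>R vone - sqrt (q - p\<^sup>2 / 4) *\<^sub>R vimag}"
    unfolding s_def[symmetric] by blast
next
  assume nonneg: "p\<^sup>2 / 4 - q \<ge> 0"
  define s where "s = sqrt (p\<^sup>2 / 4 - q)"
  have "z \<odot> z + p *\<^sub>R z + q *\<^sub>R vone = 0 \<longleftrightarrow>
      z = vector [- p / 2 + s, 0] \<or> z = vector [- p / 2 - s, 0]" for z
  proof -
    have "z \<odot> z + p *\<^sub>R z + q *\<^sub>R vone = 0 \<longleftrightarrow>
        z$2 = 0 \<and> (z$1 + p / 2 = s \<or> z$1 + p / 2 = - s)"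
      using square_diff_eq_nonneg_iff[OF nonneg, of "z$1 + p/2" "z$2"]
      unfolding circ_quadratic_iff s_def .
    also have "z$1 + p / 2 = s \<or> z$1 + p / 2 = - s \<longleftrightarrow> z$1 = - p / 2 + s \<or> z$1 = - p / 2 - s"
      by linarith
    finally show ?thesis
      unfolding vec2_eq_iff vector_2 by blast
  qed
  then show "{z :: real^2. z \<odot> z + p *\<^sub>R z + q *\<^sub>R vone = 0} =
             {vector [- p / 2 + sqrt (p\<^sup>2 / 4 - q), 0],
              vector [- p / 2 - sqrt (p\<^sup>2 / 4 - q), 0]}"
    unfolding s_def[symmetric] by blast
qed

end
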